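(* Let $\mathscr{H}$ be a complex Hilbert space, let $T\in\mathbb{B}(\mathscr{H})$ be invertible, and let $T=U|T|$ be its polar decomposition (so $U$ is unitary). Suppose the spectrum $\mathrm{sp}(U)$ is contained in some open semicircle, i.e. $\mathrm{sp}(U)\subseteq\{e^{i\lambda}:\alpha<\lambda<\alpha+\pi\}$ for some real $\alpha$. Then the Aluthge transform $\widetilde{T}=|T|^{1/2}U|T|^{1/2}$ is normal if and only if $T$ is normal.
   Context: $\mathbb{B}(\mathscr{H})$ denotes the algebra of bounded linear operators on $\mathscr{H}$. For $T\in\mathbb{B}(\mathscr{H})$, $|T|=(T^\ast T)^{1/2}$. The polar decomposition $T=U|T|$ means $U$ is a partial isometry with $\ker U=\ker|T|$ and $U^\ast U$ the projection onto $\overline{\mathrm{ran}(|T|)}$; for invertible $T$, $U$ is unitary and $|T|$ is invertible. The Aluthge transform of $T$ is $\widetilde{T}:=|T|^{1/2}U|T|^{1/2}$. *)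

theory Defs
  imports "HOL-Analysis.Analysis"
begin

text \<open>HOL-Analysis only provides real inner product spaces, so we introduce complex
vector spaces, complex inner product spaces and complex Hilbert spaces as type classes.
The inner product is linear in the second and conjugate-linear in the first argument.\<close>

class cvector = real_vector +
  fixes scaleC :: "complex \<Rightarrow> 'a \<Rightarrow> 'a"
  assumes scaleC_add_right: "scaleC a (x + y) = scaleC a x + scaleC a y"
    and scaleC_add_left: "scaleC (a + b) x = scaleC a x + scaleC b x"
    and scaleC_scaleC: "scaleC a (scaleC b x) = scaleC (a * b) x"
    and scaleC_one: "scaleC 1 x = x"
    and scaleR_scaleC: "scaleR r x = scaleC (complex_of_real r) x"

class cinner_space = cvector + real_normed_vector +
  fixes cinner :: "'a \<Rightarrow> 'a \<Rightarrow> complex"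
  assumes cinner_commute: "cinner x y = cnj (cinner y x)"
    and cinner_add_right: "cinner x (y + z) = cinner x y + cinner x z"
    and cinner_scaleC_right: "cinner x (scaleC a y) = a * cinner x y"
    and cinner_self_nonneg: "Im (cinner x x) = 0 \<and> Re (cinner x x) \<ge> 0"
    and cinner_self_eq_zero: "cinner x x = 0 \<longleftrightarrow> x = 0"
    and norm_eq_sqrt_cinner: "norm x = sqrt (Re (cinner x x))"

class chilbert = cinner_space + complete_space

definition bounded_clinear :: "('a::cinner_space \<Rightarrow> 'a) \<Rightarrow> bool" where
  "bounded_clinear T \<longleftrightarrow>
     (\<forall>x y. T (x + y) = T x + T y) \<and>
     (\<forall>c x. T (scaleC c x) = scaleC c (T x)) \<and>
     (\<exists>K. \<forall>x. norm (T x) \<le> norm x * K)"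

definition op_invertible :: "('a::cinner_space \<Rightarrow> 'a) \<Rightarrow> bool" where
  "op_invertible T \<longleftrightarrow> bounded_clinear T \<and>
     (\<exists>S. bounded_clinear S \<and> S \<circ> T = id \<and> T \<circ> S = id)"

definition adj :: "('a::cinner_space \<Rightarrow> 'a) \<Rightarrow> ('a \<Rightarrow> 'a)" where
  "adj T = (THE S. \<forall>x y. cinner (T x) y = cinner x (S y))"

definition positive_op :: "('a::cinner_space \<Rightarrow> 'a) \<Rightarrow> bool" where
  "positive_op A \<longleftrightarrow> bounded_clinear A \<and>
     (\<forall>x. Im (cinner x (A x)) = 0 \<and> Re (cinner x (A x)) \<ge> 0)"

definition op_sqrt :: "('a::cinner_space \<Rightarrow> 'a) \<Rightarrow> ('a \<Rightarrow> 'a)" where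
  "op_sqrt A = (THE B. positive_op B \<and> B \<circ> B = A)"

definition op_abs :: "('a::cinner_space \<Rightarrow> 'a) \<Rightarrow> ('a \<Rightarrow> 'a)" where
  "op_abs T = op_sqrt (adj T \<circ> T)"

definition normal_op :: "('a::cinner_space \<Rightarrow> 'a) \<Rightarrow> bool" where
  "normal_op N \<longleftrightarrow> adj N \<circ> N = N \<circ> adj N"

definition op_spectrum :: "('a::cinner_space \<Rightarrow> 'a) \<Rightarrow> complex set" where
  "op_spectrum T = {l. \<not> op_invertible (\<lambda>x. scaleC l x - T x)}"

text \<open>Polar decomposition T = U|T|: U is bounded, ker U = ker |T|, and U* U is the
orthogonal projection onto the closure of ran |T|.\<close>
definition polar_decomposition :: "('a::cinner_space \<Rightarrow> 'a) \<Rightarrow> ('a \<Rightarrow> 'a) \<Rightarrow> bool" where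
  "polar_decomposition T U \<longleftrightarrow>
     bounded_clinear U \<and>
     (\<forall>x. T x = U (op_abs T x)) \<and>
     {x. U x = 0} = {x. op_abs T x = 0} \<and>
     (\<forall>x. adj U (U x) \<in> closure (range (op_abs T)) \<and>
          (\<forall>y\<in>closure (range (op_abs T)). cinner y (x - adj U (U x)) = 0))"

definition aluthge :: "('a::cinner_space \<Rightarrow> 'a) \<Rightarrow> ('a \<Rightarrow> 'a) \<Rightarrow> ('a \<Rightarrow> 'a)" where
  "aluthge T U = op_sqrt (op_abs T) \<circ> U \<circ> op_sqrt (op_abs T)"

end

theory Submission
  imports Defs
begin

text \<open>Write \<open>P = |T|\<close> and \<open>A = P\<^sup>1\<^sup>/\<^sup>2\<close>, and let \<open>U\<close> be the unitary polar factor. Cancelling the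
  invertible \<open>A\<close> on both sides, \<open>A U A\<close> is normal iff \<open>U\<^sup>* P U = U P U\<^sup>*\<close>, i.e. iff \<open>P\<close> commutes
  with \<open>U\<^sup>2\<close>; and \<open>T = U P\<close> is normal iff \<open>P\<close> commutes with \<open>U\<close>. If \<open>P\<close> commutes with \<open>U\<^sup>2\<close>,
  then \<open>X = P U - U P\<close> anticommutes with \<open>U\<close>. After a rotation the spectrum of \<open>U\<close> lies in the
  open right half-plane, so that \<open>U + U\<^sup>*\<close> is positive definite; as it also anticommutes with
  \<open>X\<close>, it follows that \<open>X = 0\<close>.\<close>

section \<open>Complex inner product spaces\<close>

lemma scaleC_zero_right [simp]: "scaleC c (0::'a::cvector) = 0"
  using scaleC_add_right[of c 0 "0::'a"] by simp

lemma scaleC_minus_right: "scaleC c (- x) = - scaleC c (x::'a::cvector)"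
  using scaleC_add_right[of c x "- x"] by (simp add: eq_neg_iff_add_eq_0 add.commute)

lemma scaleC_diff_right: "scaleC c (x - y) = scaleC c x - scaleC c (y::'a::cvector)"
  using scaleC_add_right[of c x "- y"] by (simp add: scaleC_minus_right)

lemma scaleC_scaleR: "scaleC c (r *\<^sub>R x) = r *\<^sub>R scaleC c (x::'a::cvector)"
  by (simp add: scaleR_scaleC scaleC_scaleC mult.commute)

lemma cinner_add_left: "cinner (x + y) z = cinner x z + cinner y (z::'a::cinner_space)"
  by (metis cinner_commute cinner_add_right complex_cnj_add)

lemma cinner_scaleC_left: "cinner (scaleC a x) y = cnj a * cinner x (y::'a::cinner_space)"
  by (metis cinner_commute cinner_scaleC_right complex_cnj_mult)

lemma cinner_zero_right [simp]: "cinner x (0::'a::cinner_space) = 0"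
  using cinner_add_right[of x 0 0] by simp

lemma cinner_zero_left [simp]: "cinner (0::'a::cinner_space) x = 0"
  using cinner_add_left[of 0 0 x] by simp

lemma cinner_scaleR_right: "cinner x (r *\<^sub>R y) = r *\<^sub>R cinner x (y::'a::cinner_space)"
  by (simp add: scaleR_scaleC cinner_scaleC_right scaleR_conv_of_real)

lemma cinner_scaleR_left: "cinner (r *\<^sub>R x) y = r *\<^sub>R cinner x (y::'a::cinner_space)"
  by (simp add: scaleR_scaleC cinner_scaleC_left scaleR_conv_of_real)

lemma cinner_minus_right: "cinner x (- y) = - cinner x (y::'a::cinner_space)"
  using cinner_scaleR_right[of x "-1" y] by simp

lemma cinner_minus_left: "cinner (- x) y = - cinner x (y::'a::cinner_space)"
  using cinner_scaleR_left[of "-1" x y] by simp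

lemma cinner_diff_right: "cinner x (y - z) = cinner x y - cinner x (z::'a::cinner_space)"
  using cinner_add_right[of x y "- z"] by (simp add: cinner_minus_right)

lemma cinner_diff_left: "cinner (x - y) z = cinner x z - cinner y (z::'a::cinner_space)"
  using cinner_add_left[of x "- y" z] by (simp add: cinner_minus_left)

lemmas cinner_algebra = cinner_add_left cinner_add_right cinner_diff_left cinner_diff_right
  cinner_scaleR_left cinner_scaleR_right

lemma Re_cinner_self: "Re (cinner x x) = (norm (x::'a::cinner_space))\<^sup>2"
  using cinner_self_nonneg[of x] by (simp add: norm_eq_sqrt_cinner)

lemma cinner_self: "cinner x x = complex_of_real ((norm (x::'a::cinner_space))\<^sup>2)"
  using cinner_self_nonneg[of x] by (simp add: complex_eq_iff Re_cinner_self)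

lemma Re_cinner_commute: "Re (cinner x y) = Re (cinner y (x::'a::cinner_space))"
  using cinner_commute[of x y] by simp

lemma norm_scaleC: "norm (scaleC c x) = cmod c * norm (x::'a::cinner_space)"
proof -
  have "(norm (scaleC c x))\<^sup>2 = Re (cnj c * c * cinner x x)"
    by (simp add: Re_cinner_self[symmetric] cinner_scaleC_left cinner_scaleC_right mult.assoc
        mult.left_commute)
  also have "cnj c * c = complex_of_real ((cmod c)\<^sup>2)"
    by (metis complex_norm_square mult.commute)
  finally have "(norm (scaleC c x))\<^sup>2 = (cmod c * norm x)\<^sup>2"
    by (simp add: cinner_self power_mult_distrib flip: of_real_mult)
  then show ?thesis by simp
qed

lemma norm_add_square:
  "(norm (x + y))\<^sup>2 = (norm x)\<^sup>2 + 2 * Re (cinner x y) + (norm (y::'a::cinner_space))\<^sup>2"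
  using Re_cinner_commute[of y x] by (simp add: Re_cinner_self[symmetric] cinner_algebra)

lemma norm_diff_square:
  "(norm (x - y))\<^sup>2 = (norm x)\<^sup>2 - 2 * Re (cinner x y) + (norm (y::'a::cinner_space))\<^sup>2"
  using Re_cinner_commute[of y x] by (simp add: Re_cinner_self[symmetric] cinner_algebra)

text \<open>Cauchy-Schwarz for the real part: the squared norm of
  \<open>norm y *\<^sub>R x - norm x *\<^sub>R y\<close> is nonnegative and has
  \<open>norm x * norm y - Re (cinner x y)\<close> as a factor.\<close>

lemma Re_cinner_le_norm: "Re (cinner x y) \<le> norm x * norm (y::'a::cinner_space)"
proof (cases "x = 0 \<or> y = 0")
  case False
  have "0 \<le> (norm (norm y *\<^sub>R x - norm x *\<^sub>R y))\<^sup>2" by simp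
  also have "\<dots> = 2 * (norm x * norm y) * (norm x * norm y - Re (cinner x y))"
    by (subst norm_diff_square) (simp add: cinner_algebra power2_eq_square algebra_simps)
  finally have "0 \<le> 2 * (norm x * norm y) * (norm x * norm y - Re (cinner x y))" .
  moreover have "0 < 2 * (norm x * norm y)" using False by simp
  ultimately show ?thesis
    using zero_le_mult_iff[of "2 * (norm x * norm y)"] by smt
qed auto

lemma cmod_cinner_le_norm: "cmod (cinner x y) \<le> norm x * norm (y::'a::cinner_space)"
proof (cases "cinner x y = 0")
  case False
  \<comment> \<open>A unimodular phase that turns \<open>cinner x y\<close> into its modulus, which
    reduces the claim to the bound for real parts.\<close>
  define c where "c = cnj (cinner x y) / cmod (cinner x y)"
  have c: "cmod c = 1" using False by (simp add: c_def norm_divide)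
  have "cinner x y * cnj (cinner x y) = (complex_of_real (cmod (cinner x y)))\<^sup>2"
    by (metis complex_norm_square of_real_power)
  then have "c * cinner x y = cmod (cinner x y)"
    using False by (simp add: c_def field_simps power2_eq_square)
  then have "cmod (cinner x y) = Re (cinner x (scaleC c y))"
    by (simp add: cinner_scaleC_right)
  also have "\<dots> \<le> norm x * norm (scaleC c y)" by (rule Re_cinner_le_norm)
  finally show ?thesis by (simp add: norm_scaleC c)
qed simp

lemma bounded_bilinear_cinner: "bounded_bilinear (cinner :: 'a::cinner_space \<Rightarrow> _)"
  by standard (auto simp: cinner_algebra intro!: exI[of _ 1] cmod_cinner_le_norm)

lemma bounded_linear_scaleC: "bounded_linear (scaleC c :: 'a::cinner_space \<Rightarrow> _)"
  by (rule bounded_linear_intro[where K = "cmod c"])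
    (auto simp: scaleC_add_right scaleC_scaleR norm_scaleC mult.commute)

lemma cinner_eqI:
  assumes "\<And>y. cinner y x = cinner y (x'::'a::cinner_space)"
  shows "x = x'"
proof -
  have "cinner (x - x') (x - x') = 0"
    by (subst cinner_diff_right) (simp add: assms)
  then show ?thesis by (simp add: cinner_self_eq_zero)
qed

instance chilbert \<subseteq> banach ..

section \<open>The Riesz representation theorem and adjoints\<close>

text \<open>The first-order condition at a minimum, with \<open>d\<close> as the directional
  derivative. It is tested near the vertex of the parabola; the denominator \<open>n + 1\<close>
  also covers \<open>n = 0\<close>.\<close>

lemma quadratic_nonneg_imp_zero:
  fixes d n :: real
  assumes "\<And>t. 0 \<le> 2 * t * d + t\<^sup>2 * n" and n: "n \<ge> 0"
  shows "d = 0"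
proof -
  define t where "t = - d / (n + 1)"
  have d: "d = - t * (n + 1)" using n by (simp add: t_def)
  have "0 \<le> 2 * t * d + t\<^sup>2 * n" by (rule assms)
  also have "\<dots> = - (t\<^sup>2 * (n + 2))"
    by (simp add: d power2_eq_square algebra_simps)
  finally have "t\<^sup>2 * (n + 2) \<le> 0" by simp
  then have "t = 0" using n by (simp add: mult_le_0_iff)
  then show ?thesis using d by simp
qed

text \<open>The representing vector minimises the strictly convex functional
  \<open>\<parallel>x\<parallel>\<^sup>2 - 2 Re f x\<close>.\<close>

lemma riesz_representation:
  fixes f :: "'a::chilbert \<Rightarrow> complex"
  assumes add: "\<And>x y. f (x + y) = f x + f y"
    and scale: "\<And>c x. f (scaleC c x) = c * f x"
    and bound: "\<And>x. cmod (f x) \<le> K * norm x"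
  shows "\<exists>y. \<forall>x. f x = cinner y x"
proof -
  have scaleR: "f (r *\<^sub>R x) = r *\<^sub>R f x" for r x
    by (simp add: scaleR_scaleC scale scaleR_conv_of_real)
  have f: "bounded_linear f"
    by (rule bounded_linear_intro[where K = K]) (auto simp: add scaleR bound mult.commute)
  define \<phi> where "\<phi> x = (norm x)\<^sup>2 - 2 * Re (f x)" for x
  \<comment> \<open>Completing the square: \<open>\<phi> x + K\<^sup>2\<close> dominates
    \<open>(norm x - K)\<^sup>2\<close>.\<close>
  have lower: "- K\<^sup>2 \<le> \<phi> x" for x
  proof -
    have "Re (f x) \<le> K * norm x"
      using bound[of x] complex_Re_le_cmod[of "f x"] by linarith
    moreover have "0 \<le> (norm x - K)\<^sup>2" by simp
    ultimately show ?thesis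
      unfolding \<phi>_def by (simp add: power2_eq_square algebra_simps)
  qed
  define m where "m = Inf (range \<phi>)"
  have bdd: "bdd_below (range \<phi>)"
    using lower unfolding bdd_below_def by auto
  have m_le: "m \<le> \<phi> x" for x
    unfolding m_def by (rule cInf_lower) (auto intro: bdd)
  have "\<exists>x. \<phi> x < m + 1 / real (Suc n)" for n
    using cInf_lessD[of "range \<phi>" "m + 1 / real (Suc n)"] unfolding m_def by auto
  then obtain X where X: "\<And>n. \<phi> (X n) < m + 1 / real (Suc n)"
    by metis
  \<comment> \<open>The additive part \<open>Re f\<close> cancels, leaving the parallelogram law.
    Since \<open>\<phi>\<close> is at least \<open>m\<close> at the midpoint, a minimising sequence
    is Cauchy.\<close>
  have parallelogram: "(norm (x - y))\<^sup>2 = 2 * \<phi> x + 2 * \<phi> y - 4 * \<phi> ((1/2) *\<^sub>R (x + y))" for x y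
    unfolding \<phi>_def
    by (simp add: norm_diff_square norm_add_square scaleR add power_divide cinner_scaleR_left
        cinner_scaleR_right field_simps)
  have close: "(norm (X i - X j))\<^sup>2 < 4 / real (Suc n)" if "i \<ge> n" "j \<ge> n" for i j n
  proof -
    have "1 / real (Suc i) \<le> 1 / real (Suc n)" "1 / real (Suc j) \<le> 1 / real (Suc n)"
      using that by (auto simp: divide_simps)
    then show ?thesis
      using X[of i] X[of j] m_le[of "(1/2) *\<^sub>R (X i + X j)"] parallelogram[of "X i" "X j"]
      by simp
  qed
  have "Cauchy X"
  proof (rule metric_CauchyI)
    fix e :: real assume e: "0 < e"
    obtain n where n: "inverse (real (Suc n)) < e\<^sup>2 / 4"
      using reals_Archimedean[of "e\<^sup>2 / 4"] e by auto
    have "dist (X i) (X j) < e" if "i \<ge> n" "j \<ge> n" for i j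
    proof -
      have "(norm (X i - X j))\<^sup>2 < e\<^sup>2"
        using close[OF that] n by (simp add: inverse_eq_divide)
      then have "norm (X i - X j) < e"
        by (rule power2_less_imp_less) (use e in simp)
      then show ?thesis by (simp add: dist_norm)
    qed
    then show "\<exists>M. \<forall>i\<ge>M. \<forall>j\<ge>M. dist (X i) (X j) < e" by blast
  qed
  then obtain y where y: "X \<longlonglongrightarrow> y"
    by (auto simp: Cauchy_convergent_iff convergent_def)
  have "(\<lambda>n. \<phi> (X n)) \<longlonglongrightarrow> \<phi> y"
    unfolding \<phi>_def by (intro tendsto_intros y bounded_linear.tendsto[OF f])
  moreover have "(\<lambda>n. m + 1 / real (Suc n)) \<longlonglongrightarrow> m + 0"
    by (intro tendsto_intros LIMSEQ_Suc[OF lim_1_over_n])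
  ultimately have "\<phi> y \<le> m + 0"
    by (rule LIMSEQ_le) (use X in \<open>auto intro: less_imp_le\<close>)
  then have min: "\<phi> y \<le> \<phi> x" for x
    using m_le[of x] by simp
  \<comment> \<open>Vary the minimiser \<open>y\<close> in the direction \<open>x\<close>. Only real
    multiples are used, so this gives real parts; imaginary parts follow below by replacing
    \<open>x\<close> with \<open>scaleC \<i> x\<close>.\<close>
  have Re: "Re (f x) = Re (cinner y x)" for x
  proof -
    have "0 \<le> 2 * t * (Re (cinner y x) - Re (f x)) + t\<^sup>2 * (norm x)\<^sup>2" for t
      using min[of "y + t *\<^sub>R x"] unfolding \<phi>_def
      by (simp add: norm_add_square add scaleR cinner_algebra power_mult_distrib algebra_simps)
    then have "Re (cinner y x) - Re (f x) = 0"
      by (rule quadratic_nonneg_imp_zero) simp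
    then show ?thesis by simp
  qed
  have "f x = cinner y x" for x
    using Re[of x] Re[of "scaleC \<i> x"] by (simp add: scale cinner_scaleC_right complex_eq_iff)
  then show ?thesis by blast
qed

section \<open>Bounded complex-linear operators and their adjoints\<close>

lemma bounded_clinear_scaleC: "bounded_clinear T \<Longrightarrow> T (scaleC c x) = scaleC c (T x)"
  by (auto simp: bounded_clinear_def)

lemma bounded_clinear_imp_bounded_linear: "bounded_clinear T \<Longrightarrow> bounded_linear T"
  unfolding bounded_clinear_def by (auto intro: bounded_linear_intro simp: scaleR_scaleC)

lemma bounded_clinearI:
  assumes "bounded_linear T" and "\<And>c x. T (scaleC c x) = scaleC c (T x)"
  shows "bounded_clinear T"
  using assms bounded_linear.bounded[OF assms(1)]
  by (auto simp: bounded_clinear_def linear_simps)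

lemmas bounded_clinear_simps = bounded_clinear_scaleC
  linear_simps[OF bounded_clinear_imp_bounded_linear]

lemma bounded_clinear_bound:
  assumes "bounded_clinear T"
  obtains K where "K > 0" and "\<And>x. norm (T x) \<le> K * norm x"
  using bounded_linear.pos_bounded[OF bounded_clinear_imp_bounded_linear[OF assms]]
  by (metis mult.commute)

lemma bounded_clinear_compose:
  assumes "bounded_clinear S" "bounded_clinear T"
  shows "bounded_clinear (\<lambda>x. S (T x))"
  using assms by (intro bounded_clinearI)
    (auto intro: bounded_linear_compose bounded_clinear_imp_bounded_linear
      simp: bounded_clinear_scaleC)

lemma bounded_clinear_plus:
  assumes "bounded_clinear S" "bounded_clinear T"
  shows "bounded_clinear (\<lambda>x. S x + T x)"
  using assms by (intro bounded_clinearI)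
    (auto intro: bounded_linear_add bounded_clinear_imp_bounded_linear
      simp: bounded_clinear_scaleC scaleC_add_right)

lemma bounded_clinear_minus:
  assumes "bounded_clinear S" "bounded_clinear T"
  shows "bounded_clinear (\<lambda>x. S x - T x)"
  using assms by (intro bounded_clinearI)
    (auto intro: bounded_linear_sub bounded_clinear_imp_bounded_linear
      simp: bounded_clinear_scaleC scaleC_diff_right)

lemma bounded_clinear_scaleC_const: "bounded_clinear (scaleC c)"
  by (intro bounded_clinearI bounded_linear_scaleC) (simp add: scaleC_scaleC mult.commute)

lemma bounded_clinear_scaleR_const: "bounded_clinear (\<lambda>x. r *\<^sub>R x)"
  by (intro bounded_clinearI bounded_linear_scaleR_right) (simp add: scaleC_scaleR)

text \<open>\<open>adj\<close> is a definite description and the inner product separates points, so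
  exhibiting one candidate determines it. Adjoints of concrete operators are computed this
  way.\<close>

lemma adj_eqI:
  assumes "\<And>x y. cinner (T x) y = cinner x (S y)"
  shows "adj T = S"
  unfolding adj_def
proof (rule the_equality)
  show "\<forall>x y. cinner (T x) y = cinner x (S y)" using assms by blast
next
  fix S' assume "\<forall>x y. cinner (T x) y = cinner x (S' y)"
  then show "S' = S" using assms by (metis cinner_eqI ext)
qed

text \<open>Existence of the adjoint: Riesz applied to \<open>cinner y (T x)\<close> as a functional
  of \<open>x\<close>, for each fixed \<open>y\<close>.\<close>

lemma cinner_adj_right:
  fixes T :: "'a::chilbert \<Rightarrow> 'a"
  assumes T: "bounded_clinear T"
  shows "cinner x (adj T y) = cinner (T x) y"
proof -
  obtain K where K: "K > 0" "\<And>x. norm (T x) \<le> K * norm x"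
    using bounded_clinear_bound[OF T] by blast
  have "\<exists>w. \<forall>x. cinner y (T x) = cinner w x" for y
  proof (rule riesz_representation)
    show "cmod (cinner y (T x)) \<le> norm y * K * norm x" for x
      using cmod_cinner_le_norm[of y "T x"] mult_left_mono[OF K(2)[of x] norm_ge_zero[of y]]
      by (simp add: mult.assoc)
  qed (auto simp: bounded_clinear_simps[OF T] cinner_add_right cinner_scaleC_right)
  then obtain S where "\<And>x y. cinner y (T x) = cinner (S y) x"
    by metis
  then have S: "\<And>x y. cinner (T x) y = cinner x (S y)"
    by (metis cinner_commute)
  then show ?thesis using adj_eqI[of T S] by simp
qed

lemma bounded_clinear_adj:
  fixes T :: "'a::chilbert \<Rightarrow> 'a"
  assumes T: "bounded_clinear T"
  shows "bounded_clinear (adj T)"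
proof -
  obtain K where K: "K > 0" "\<And>x. norm (T x) \<le> K * norm x"
    using bounded_clinear_bound[OF T] by blast
  have "norm (adj T y) \<le> norm y * K" for y
  proof (cases "adj T y = 0")
    case False
    have "norm (adj T y) * norm (adj T y) = Re (cinner (T (adj T y)) y)"
      using Re_cinner_self[of "adj T y"] by (simp add: cinner_adj_right[OF T] power2_eq_square)
    also have "\<dots> \<le> norm (T (adj T y)) * norm y" by (rule Re_cinner_le_norm)
    also have "\<dots> \<le> K * norm (adj T y) * norm y" by (intro mult_right_mono K) auto
    finally show ?thesis using False by (simp add: mult.commute mult.left_commute)
  qed (use K in auto)
  moreover have "adj T (x + y) = adj T x + adj T y" for x y
    by (rule cinner_eqI) (simp add: cinner_adj_right[OF T] cinner_add_right)
  moreover have "adj T (scaleC c x) = scaleC c (adj T x)" for c x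
    by (rule cinner_eqI) (simp add: cinner_adj_right[OF T] cinner_scaleC_right)
  ultimately show ?thesis unfolding bounded_clinear_def by blast
qed

section \<open>Positive operators and their square roots\<close>

text \<open>Polarization: reality of the quadratic form at \<open>x + y\<close> and at
  \<open>x + scaleC \<i> y\<close> fixes the imaginary and real parts of the Hermitian
  identity.\<close>

lemma positive_op_selfadjoint:
  assumes A: "positive_op A"
  shows "cinner (A x) y = cinner x (A y)"
proof -
  have lin: "bounded_clinear A" and im: "\<And>x. Im (cinner x (A x)) = 0"
    using A by (auto simp: positive_op_def)
  have "Im (cinner x (A y) + cinner y (A x)) = 0"
    using im[of "x + y"] im[of x] im[of y] by (simp add: bounded_clinear_simps[OF lin] cinner_algebra)
  moreover have "Im (\<i> * cinner x (A y) - \<i> * cinner y (A x)) = 0"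
    using im[of "x + scaleC \<i> y"] im[of x] im[of y]
    by (simp add: bounded_clinear_simps[OF lin] cinner_algebra cinner_scaleC_left cinner_scaleC_right)
  ultimately have "cinner x (A y) = cnj (cinner y (A x))"
    by (simp add: complex_eq_iff)
  then show ?thesis by (metis cinner_commute)
qed

text \<open>This is the operator inequality \<open>A\<^sup>2 \<le> K A\<close>. It comes from the
  form of \<open>A\<close> at \<open>K *\<^sub>R x - A x\<close>, without a square root of
  \<open>A\<close>, because the construction of square roots relies on it.\<close>

lemma positive_op_norm_square_le:
  assumes A: "positive_op A" and K: "K > 0" "\<And>x. norm (A x) \<le> K * norm x"
  shows "(norm (A x))\<^sup>2 \<le> K * Re (cinner x (A x))"
proof -
  have lin: "bounded_clinear A" and nn: "\<And>x. 0 \<le> Re (cinner x (A x))"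
    using A by (auto simp: positive_op_def)
  have "Re (cinner (A x) (A (A x))) \<le> norm (A x) * (K * norm (A x))"
    by (intro order.trans[OF Re_cinner_le_norm] mult_left_mono K) auto
  moreover have "0 \<le> Re (cinner (K *\<^sub>R x - A x) (A (K *\<^sub>R x - A x)))" by (rule nn)
  moreover have "Re (cinner (K *\<^sub>R x - A x) (A (K *\<^sub>R x - A x)))
      = K\<^sup>2 * Re (cinner x (A x)) - 2 * K * (norm (A x))\<^sup>2 + Re (cinner (A x) (A (A x)))"
    using arg_cong[OF positive_op_selfadjoint[OF A, of x "A x"], of Re]
    by (simp add: bounded_clinear_simps[OF lin] cinner_algebra Re_cinner_self power2_eq_square
        algebra_simps)
  ultimately have "0 \<le> K * (K * Re (cinner x (A x)) - (norm (A x))\<^sup>2)"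
    by (simp add: power2_eq_square algebra_simps)
  then show ?thesis using K(1) by (simp add: zero_le_mult_iff)
qed

text \<open>The uniform bound \<open>\<delta>\<close> expresses that \<open>A\<close> is positive
  and invertible. It is what makes the contraction constant in the construction of the square root
  smaller than 1.\<close>

definition posdef_op :: "('a::cinner_space \<Rightarrow> 'a) \<Rightarrow> bool" where
  "posdef_op A \<longleftrightarrow> positive_op A \<and> (\<exists>\<delta>>0. \<forall>x. \<delta> * (norm x)\<^sup>2 \<le> Re (cinner x (A x)))"

lemma posdef_op_inj:
  assumes "posdef_op A" "A x = A y"
  shows "x = y"
proof -
  obtain \<delta> where "\<delta> > 0" and \<delta>: "\<And>x. \<delta> * (norm x)\<^sup>2 \<le> Re (cinner x (A x))"
    using assms by (auto simp: posdef_op_def)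
  have "A (x - y) = 0"
    using assms bounded_clinear_simps[of A] by (simp add: posdef_op_def positive_op_def)
  then show ?thesis
    using \<delta>[of "x - y"] \<open>\<delta> > 0\<close> by (simp add: mult_le_0_iff)
qed

lemma posdef_op_adj_compose:
  fixes T :: "'a::chilbert \<Rightarrow> 'a"
  assumes T: "bounded_clinear T" and k: "k > 0" "\<And>x. k * norm x \<le> norm (T x)"
  shows "posdef_op (adj T \<circ> T)"
proof -
  have eq: "cinner x ((adj T \<circ> T) x) = complex_of_real ((norm (T x))\<^sup>2)" for x
    by (simp add: cinner_adj_right[OF T] cinner_self)
  have "k\<^sup>2 * (norm x)\<^sup>2 \<le> (norm (T x))\<^sup>2" for x
    using power_mono[OF k(2)[of x], of 2] k(1) by (simp add: power_mult_distrib)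
  then show ?thesis
    unfolding posdef_op_def positive_op_def eq
    using bounded_clinear_compose[OF bounded_clinear_adj[OF T] T] k(1)
    by (auto simp: o_def intro!: exI[of _ "k\<^sup>2"])
qed

lemma posdef_op_norm_ge:
  assumes "posdef_op A"
  obtains \<delta> where "\<delta> > 0" and "\<And>x. \<delta> * norm x \<le> norm (A x)"
proof -
  obtain \<delta> where "\<delta> > 0" and \<delta>: "\<And>x. \<delta> * (norm x)\<^sup>2 \<le> Re (cinner x (A x))"
    using assms by (auto simp: posdef_op_def)
  have "\<delta> * norm x \<le> norm (A x)" for x
  proof (cases "x = 0")
    case False
    have "norm x * (\<delta> * norm x) \<le> norm x * norm (A x)"
      using order.trans[OF \<delta>[of x] Re_cinner_le_norm]
      by (simp add: power2_eq_square mult.left_commute)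
    then show ?thesis using False by simp
  qed simp
  with \<open>\<delta> > 0\<close> show ?thesis using that by blast
qed

lemma posdef_op_square:
  fixes A :: "'a::chilbert \<Rightarrow> 'a"
  assumes A: "posdef_op A"
  shows "posdef_op (A \<circ> A)"
proof -
  have pos: "positive_op A" and lin: "bounded_clinear A"
    using A by (auto simp: posdef_op_def positive_op_def)
  have "adj A = A" by (rule adj_eqI) (rule positive_op_selfadjoint[OF pos])
  then show ?thesis
    using posdef_op_norm_ge[OF A] posdef_op_adj_compose[OF lin] by metis
qed

text \<open>After scaling, \<open>A = 1 - B\<close> with \<open>\<parallel>B\<parallel> \<le> q < 1\<close>. Then \<open>Y \<mapsto> (B + Y\<^sup>2) / 2\<close> is a contraction
  of the ball of radius \<open>q\<close>, and its fixed point satisfies \<open>(1 - Y)\<^sup>2 = 1 - B\<close>. All the required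
  algebraic properties define closed sets that this map preserves.\<close>

lemma posdef_op_sqrt_exists:
  fixes A :: "'a::chilbert \<Rightarrow> 'a"
  assumes A: "posdef_op A"
  shows "\<exists>S. posdef_op S \<and> S \<circ> S = A \<and>
    (\<forall>C. bounded_clinear C \<longrightarrow> C \<circ> A = A \<circ> C \<longrightarrow> C \<circ> S = S \<circ> C)"
proof -
  have pos: "positive_op A" and lin: "bounded_clinear A"
    using A by (auto simp: posdef_op_def positive_op_def)
  obtain \<delta> where "\<delta> > 0" and \<delta>: "\<And>x. \<delta> * (norm x)\<^sup>2 \<le> Re (cinner x (A x))"
    using A by (auto simp: posdef_op_def)
  obtain K0 where K0: "K0 > 0" "\<And>x. norm (A x) \<le> K0 * norm x"
    using bounded_clinear_bound[OF lin] by blast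
  \<comment> \<open>The maximum keeps \<open>K\<close> a norm bound for \<open>A\<close> and ensures
    \<open>\<delta> / K \<le> 1\<close>, so that the radicand of \<open>q\<close> is nonnegative.
    The value of \<open>q\<close> is the norm bound for \<open>B\<close> that
    \<open>A\<^sup>2 \<le> K A\<close> yields.\<close>
  define K where "K = max K0 \<delta>"
  have K: "K > 0" "\<delta> \<le> K" using K0 by (auto simp: K_def)
  have AK: "norm (A x) \<le> K * norm x" for x
    using K0(2)[of x] mult_right_mono[of K0 K "norm x"] by (simp add: K_def)
  define q where "q = sqrt (1 - \<delta> / K)"
  have q: "0 \<le> q" "q < 1" using K \<open>\<delta> > 0\<close> by (auto simp: q_def)
  define B where "B x = x - (1 / K) *\<^sub>R A x" for x
  have linB: "bounded_clinear B"
    unfolding B_def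
    using bounded_clinear_minus[OF bounded_clinear_scaleC_const[of 1]
        bounded_clinear_compose[OF bounded_clinear_scaleR_const[of "1 / K"] lin]]
    by (simp add: scaleC_one)
  have normB: "norm (B x) \<le> q * norm x" for x
  proof -
    have "(norm (B x))\<^sup>2 = (norm x)\<^sup>2 - 2 * Re (cinner x (A x)) / K + (norm (A x))\<^sup>2 / K\<^sup>2"
      unfolding B_def by (simp add: norm_diff_square cinner_algebra power_divide)
    also have "\<dots> \<le> (norm x)\<^sup>2 - Re (cinner x (A x)) / K"
      using positive_op_norm_square_le[OF pos K(1) AK, of x] K(1)
      by (simp add: power2_eq_square field_simps)
    also have "\<dots> \<le> (norm x)\<^sup>2 - \<delta> * (norm x)\<^sup>2 / K"
      using \<delta>[of x] K(1) by (simp add: divide_right_mono)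
    also have "\<dots> = (1 - \<delta> / K) * (norm x)\<^sup>2"
      by (simp add: algebra_simps)
    also have "\<dots> = (q * norm x)\<^sup>2"
      using K \<open>\<delta> > 0\<close> by (simp add: q_def power_mult_distrib)
    finally show ?thesis by (rule power2_le_imp_le) (use q in simp)
  qed
  have symB: "cinner (B x) y = cinner x (B y)" for x y
    by (simp add: B_def cinner_algebra positive_op_selfadjoint[OF pos])
  define b where "b = Blinfun B"
  have b: "blinfun_apply b = B"
    unfolding b_def by (rule bounded_linear_Blinfun_apply)
      (rule bounded_clinear_imp_bounded_linear[OF linB])
  have normb: "norm b \<le> q"
    by (rule norm_blinfun_bound) (use q normB b in auto)
  \<comment> \<open>Elements of the Banach space of bounded operators are only real-linear here, so
    complex linearity is carried along in \<open>M\<close>, together with symmetry and commutation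
    with everything that commutes with \<open>A\<close>.\<close>
  define M where "M = {Y :: 'a \<Rightarrow>\<^sub>L 'a. norm Y \<le> q
    \<and> (\<forall>c x. blinfun_apply Y (scaleC c x) = scaleC c (blinfun_apply Y x))
    \<and> (\<forall>x y. cinner (blinfun_apply Y x) y = cinner x (blinfun_apply Y y))
    \<and> (\<forall>C. bounded_clinear C \<longrightarrow> C \<circ> A = A \<circ> C
          \<longrightarrow> (\<forall>x. C (blinfun_apply Y x) = blinfun_apply Y (C x)))}"
  define F where "F Y = (1/2) *\<^sub>R (b + (Y o\<^sub>L Y))" for Y
  have F: "blinfun_apply (F Y) x = (1/2) *\<^sub>R (B x + blinfun_apply Y (blinfun_apply Y x))" for Y x
    by (simp add: F_def b blinfun.scaleR_left blinfun.add_left)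
  have cont: "continuous_on UNIV (\<lambda>Y. blinfun_apply Y x)" for x :: 'a
    by (intro continuous_intros)
  have "closed {Y :: 'a \<Rightarrow>\<^sub>L 'a. norm Y \<le> q}"
    by (intro closed_Collect_le continuous_intros)
  moreover have "closed {Y :: 'a \<Rightarrow>\<^sub>L 'a. blinfun_apply Y (scaleC c x) = scaleC c (blinfun_apply Y x)}"
    for c x
    by (intro closed_Collect_eq cont bounded_linear.continuous_on[OF bounded_linear_scaleC])
  moreover have "closed {Y :: 'a \<Rightarrow>\<^sub>L 'a. cinner (blinfun_apply Y x) y = cinner x (blinfun_apply Y y)}"
    for x y
    by (intro closed_Collect_eq cont continuous_on_const
        bounded_bilinear.continuous_on[OF bounded_bilinear_cinner])
  moreover have "closed {Y :: 'a \<Rightarrow>\<^sub>L 'a. bounded_clinear C \<longrightarrow> C \<circ> A = A \<circ> C \<longrightarrow>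
      (\<forall>x. C (blinfun_apply Y x) = blinfun_apply Y (C x))}" for C
  proof (cases "bounded_clinear C \<and> C \<circ> A = A \<circ> C")
    case True
    then have C: "bounded_linear C"
      by (simp add: bounded_clinear_imp_bounded_linear)
    have "continuous_on UNIV (\<lambda>Y. C (blinfun_apply Y x))" for x :: 'a
      by (rule bounded_linear.continuous_on[OF C cont])
    then have "closed {Y :: 'a \<Rightarrow>\<^sub>L 'a. \<forall>x. C (blinfun_apply Y x) = blinfun_apply Y (C x)}"
      by (intro closed_Collect_all closed_Collect_eq cont)
    then show ?thesis using True by simp
  next
    case False
    then have "{Y :: 'a \<Rightarrow>\<^sub>L 'a. bounded_clinear C \<longrightarrow> C \<circ> A = A \<circ> C \<longrightarrow>
      (\<forall>x. C (blinfun_apply Y x) = blinfun_apply Y (C x))} = UNIV" by blast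
    then show ?thesis by simp
  qed
  ultimately have "closed M"
    unfolding M_def by (intro closed_Collect_conj closed_Collect_all)
  then have "complete M" by (simp add: complete_eq_closed)
  moreover have "M \<noteq> {}"
    using q by (auto simp: M_def bounded_clinear_simps intro!: exI[of _ 0])
  moreover have "F ` M \<subseteq> M"
  proof clarify
    fix Y assume Y: "Y \<in> M"
    have "norm (b + (Y o\<^sub>L Y)) \<le> q + q * q"
      using Y q normb by (intro norm_triangle_mono order.trans[OF norm_blinfun_compose] mult_mono)
        (auto simp: M_def)
    also have "\<dots> \<le> 2 * q" using q by (simp add: mult_left_le)
    finally have "norm (F Y) \<le> q" by (simp add: F_def)
    moreover have "C (B x) = B (C x)" if "bounded_clinear C" "C \<circ> A = A \<circ> C" for C x
      using that by (simp add: B_def bounded_clinear_simps fun_eq_iff)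
    ultimately show "F Y \<in> M"
      using Y by (auto simp: M_def F bounded_clinear_simps bounded_clinear_simps[OF linB]
          scaleC_scaleR scaleC_add_right cinner_algebra symB)
  qed
  moreover have "dist (F Y) (F Z) \<le> q * dist Y Z" if "Y \<in> M" "Z \<in> M" for Y Z
  proof -
    \<comment> \<open>The noncommutative identity
      \<open>Y\<^sup>2 - Z\<^sup>2 = Y (Y - Z) + (Y - Z) Z\<close>; each summand costs a factor
      \<open>q\<close>, and the half in \<open>F\<close> compensates for having two of them.\<close>
    have "F Y - F Z = (1/2) *\<^sub>R ((Y o\<^sub>L (Y - Z)) + ((Y - Z) o\<^sub>L Z))"
      by (rule blinfun_eqI)
        (simp add: F blinfun.diff_left blinfun.add_left blinfun.scaleR_left blinfun.diff_right
          algebra_simps)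
    moreover have "norm ((Y o\<^sub>L (Y - Z)) + ((Y - Z) o\<^sub>L Z)) \<le> q * norm (Y - Z) + norm (Y - Z) * q"
      using that q by (intro norm_triangle_mono order.trans[OF norm_blinfun_compose] mult_mono)
        (auto simp: M_def)
    ultimately show ?thesis by (simp add: dist_norm)
  qed
  ultimately obtain Y where Y: "Y \<in> M" "F Y = Y"
    using Banach_fix[of M q F] q by blast
  have YY: "Y (Y x) = 2 *\<^sub>R Y x - B x" for x
  proof -
    have "2 *\<^sub>R blinfun_apply (F Y) x = B x + Y (Y x)" by (simp only: F) simp
    then show ?thesis by (simp add: Y(2))
  qed
  \<comment> \<open>Since \<open>A = K (1 - B)\<close> and \<open>(1 - Y)\<^sup>2 = 1 - B\<close>,
    the root is \<open>sqrt K\<close> times \<open>1 - Y\<close>. It is bounded below because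
    \<open>norm Y \<le> q < 1\<close>.\<close>
  define S where "S x = sqrt K *\<^sub>R (x - Y x)" for x
  have linS: "bounded_clinear S"
    unfolding S_def using Y(1)
    by (intro bounded_clinearI bounded_linear_scaleR_right[THEN bounded_linear_compose]
        bounded_linear_sub bounded_linear_ident blinfun.bounded_linear_right)
      (auto simp: M_def scaleC_scaleR scaleC_diff_right)
  have "S (S x) = A x" for x
  proof -
    have "S (S x) = K *\<^sub>R (x - Y x - Y (x - Y x))"
      using K(1) by (simp add: S_def blinfun.scaleR_right flip: scaleR_diff_right)
    also have "x - Y x - Y (x - Y x) = (1 / K) *\<^sub>R A x"
      by (simp add: blinfun.diff_right YY B_def scaleR_2)
    finally show ?thesis using K(1) by simp
  qed
  then have SS: "S \<circ> S = A" by auto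
  have "Im (cinner x (Y x)) = 0" for x
    using Y(1) cinner_commute[of x "Y x"] by (auto simp: M_def complex_eq_iff)
  then have "Im (cinner x (S x)) = 0" for x
    by (simp add: S_def cinner_algebra cinner_self)
  moreover have S_ge: "sqrt K * (1 - q) * (norm x)\<^sup>2 \<le> Re (cinner x (S x))" for x
  proof -
    have "norm (Y x) \<le> q * norm x"
      using Y(1) norm_blinfun[of Y x] mult_right_mono[of "norm Y" q "norm x"] by (auto simp: M_def)
    then have "Re (cinner x (Y x)) \<le> norm x * (q * norm x)"
      by (intro order.trans[OF Re_cinner_le_norm] mult_left_mono) auto
    then have "(1 - q) * (norm x)\<^sup>2 \<le> (norm x)\<^sup>2 - Re (cinner x (Y x))"
      by (simp add: power2_eq_square algebra_simps)
    then show ?thesis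
      using K(1) by (simp add: S_def cinner_algebra Re_cinner_self mult.assoc)
  qed
  moreover have "0 < sqrt K * (1 - q)" using K q by simp
  ultimately have "posdef_op S"
    unfolding posdef_op_def positive_op_def using linS
    by (metis (no_types, opaque_lifting) less_imp_le mult_nonneg_nonneg order.trans zero_le_power2)
  moreover have "C \<circ> S = S \<circ> C" if "bounded_clinear C" "C \<circ> A = A \<circ> C" for C
    using Y(1) that by (auto simp: M_def S_def bounded_clinear_simps)
  ultimately show ?thesis using SS by blast
qed

text \<open>For uniqueness, a positive root \<open>R\<close> commutes with
  \<open>A = R \<circ> R\<close>, hence with the constructed root \<open>S\<close>. So
  \<open>S + R\<close> kills \<open>z = S x - R x\<close>; both forms are nonnegative at
  \<open>z\<close> and that of \<open>S\<close> is bounded below, whence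
  \<open>z = 0\<close>.\<close>

lemma op_sqrt_posdef:
  fixes A :: "'a::chilbert \<Rightarrow> 'a"
  assumes A: "posdef_op A"
  shows posdef_op_sqrt: "posdef_op (op_sqrt A)"
    and op_sqrt_square: "op_sqrt A \<circ> op_sqrt A = A"
    and op_sqrt_commute: "bounded_clinear C \<Longrightarrow> C \<circ> A = A \<circ> C \<Longrightarrow> C \<circ> op_sqrt A = op_sqrt A \<circ> C"
    and op_sqrt_unique: "positive_op R \<Longrightarrow> R \<circ> R = A \<Longrightarrow> op_sqrt A = R"
proof -
  obtain S where S: "posdef_op S" "S \<circ> S = A"
    and comm: "\<And>C. bounded_clinear C \<Longrightarrow> C \<circ> A = A \<circ> C \<Longrightarrow> C \<circ> S = S \<circ> C"
    using posdef_op_sqrt_exists[OF A] by blast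
  have uniq: "R = S" if R: "positive_op R" "R \<circ> R = A" for R
  proof
    fix x
    obtain \<delta> where "\<delta> > 0" and \<delta>: "\<And>x. \<delta> * (norm x)\<^sup>2 \<le> Re (cinner x (S x))"
      using S by (auto simp: posdef_op_def)
    have lin: "bounded_clinear R" "bounded_clinear S"
      using R(1) S(1) by (auto simp: positive_op_def posdef_op_def)
    have "R \<circ> S = S \<circ> R"
      by (rule comm[OF lin(1)]) (simp add: o_assoc flip: R(2))
    then have RS: "R (S y) = S (R y)" for y by (simp add: fun_eq_iff)
    have sq: "R (R y) = S (S y)" for y
      using S(2) R(2) by (metis comp_apply)
    define z where "z = S x - R x"
    have "S z + R z = 0"
      by (simp add: z_def bounded_clinear_simps[OF lin(1)] bounded_clinear_simps[OF lin(2)] RS sq)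
    then have "Re (cinner z (S z)) + Re (cinner z (R z)) = 0"
      by (metis cinner_add_right cinner_zero_right plus_complex.simps(1) zero_complex.simps(1))
    moreover have "0 \<le> Re (cinner z (R z))" using R(1) by (simp add: positive_op_def)
    ultimately have "\<delta> * (norm z)\<^sup>2 \<le> 0" using \<delta>[of z] by linarith
    then have "z = 0" using \<open>\<delta> > 0\<close> by (simp add: mult_le_0_iff)
    then show "R x = S x" by (simp add: z_def)
  qed
  have "op_sqrt A = S"
    unfolding op_sqrt_def using S uniq by (intro the_equality) (auto simp: posdef_op_def)
  then show "posdef_op (op_sqrt A)" "op_sqrt A \<circ> op_sqrt A = A"
    "bounded_clinear C \<Longrightarrow> C \<circ> A = A \<circ> C \<Longrightarrow> C \<circ> op_sqrt A = op_sqrt A \<circ> C"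
    "positive_op R \<Longrightarrow> R \<circ> R = A \<Longrightarrow> op_sqrt A = R"
    using S comm uniq by auto
qed

text \<open>By uniqueness \<open>A\<close> is the square root of \<open>A \<circ> A\<close>, so it
  inherits the commutation property of square roots.\<close>

lemma posdef_op_commute_of_square:
  fixes A :: "'a::chilbert \<Rightarrow> 'a"
  assumes A: "posdef_op A" and C: "bounded_clinear C" and comm: "\<And>x. C (A (A x)) = A (A (C x))"
  shows "C (A x) = A (C x)"
proof -
  have "op_sqrt (A \<circ> A) = A"
    using A by (intro op_sqrt_unique posdef_op_square) (auto simp: posdef_op_def)
  moreover have "C \<circ> op_sqrt (A \<circ> A) = op_sqrt (A \<circ> A) \<circ> C"
    by (rule op_sqrt_commute[OF posdef_op_square[OF A] C]) (auto simp: comm)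
  ultimately show ?thesis by (simp add: fun_eq_iff)
qed

section \<open>Unitary operators with spectrum in a half-plane\<close>

text \<open>The infimum \<open>m\<close> of the numerical range of \<open>V + V\<^sup>*\<close> cannot be \<open>\<le> 0\<close>: writing
  \<open>m = z + cnj z\<close> with \<open>|z| = 1\<close>, the operator \<open>V + V\<^sup>* - m = V\<^sup>* (V - z) (V - cnj z)\<close> would be
  positive and bounded below, so \<open>m\<close> could be increased.\<close>

lemma posdef_op_unitary_plus_adj:
  fixes V :: "'a::chilbert \<Rightarrow> 'a"
  assumes V: "bounded_clinear V" and unitary: "\<And>x. adj V (V x) = x" "\<And>x. V (adj V x) = x"
    and below: "\<And>z. Re z \<le> 0 \<Longrightarrow> \<exists>k>0. \<forall>x. k * norm x \<le> norm (V x - scaleC z x)"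
  shows "posdef_op (\<lambda>x. V x + adj V x)"
proof -
  define H where "H x = V x + adj V x" for x
  have linH: "bounded_clinear H"
    unfolding H_def by (intro bounded_clinear_plus bounded_clinear_adj V)
  have normV: "norm (V x) = norm x" for x
  proof -
    have "cinner (V x) (V x) = cinner x x"
      by (simp add: unitary flip: cinner_adj_right[OF V])
    then show ?thesis by (simp add: norm_eq_sqrt_cinner)
  qed
  have eqH: "cinner x (H x) = cinner x (V x) + cnj (cinner x (V x))" for x
    by (simp add: H_def cinner_add_right cinner_adj_right[OF V] flip: cinner_commute)
  have ImH: "Im (cinner x (H x)) = 0" for x
    by (simp add: eqH)
  have ReH: "- 2 * (norm x)\<^sup>2 \<le> Re (cinner x (H x))" for x
  proof -
    have "\<bar>Re (cinner x (V x))\<bar> \<le> norm x * norm x"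
      using order.trans[OF abs_Re_le_cmod cmod_cinner_le_norm[of x "V x"]] by (simp add: normV)
    then show ?thesis by (simp add: eqH power2_eq_square)
  qed
  have "\<exists>\<delta>>0. \<forall>x. \<delta> * (norm x)\<^sup>2 \<le> Re (cinner x (H x))"
  proof (cases "\<exists>x::'a. x \<noteq> 0")
    \<comment> \<open>In the zero space the unit sphere is empty and an infimum over it would carry
      no information.\<close>
    case False
    then have zero: "x = 0" for x :: 'a by blast
    have "1 * (norm x)\<^sup>2 \<le> Re (cinner x (H x))" for x
      using zero[of x] by simp
    then show ?thesis using zero_less_one by blast
  next
    case True
    then obtain e :: 'a where e: "norm e = 1" by (metis norm_sgn)
    define R where "R = (\<lambda>x. Re (cinner x (H x))) ` {x. norm x = 1}"
    define m where "m = Inf R"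
    have R_ge: "-2 \<le> r" if r: "r \<in> R" for r
    proof -
      obtain x where "norm x = 1" "r = Re (cinner x (H x))"
        using r by (auto simp: R_def)
      then show ?thesis using ReH[of x] by simp
    qed
    then have "bdd_below R" unfolding bdd_below_def by blast
    have "R \<noteq> {}" using e by (auto simp: R_def)
    then have m2: "-2 \<le> m"
      unfolding m_def using R_ge by (rule cInf_greatest)
    have ge_iff: "(\<forall>x. a * (norm x)\<^sup>2 \<le> Re (cinner x (H x))) \<longleftrightarrow> (\<forall>r\<in>R. a \<le> r)" for a
    proof (intro iffI allI ballI)
      fix x assume *: "\<forall>r\<in>R. a \<le> r"
      show "a * (norm x)\<^sup>2 \<le> Re (cinner x (H x))"
      proof (cases "x = 0")
        case False
        then have "a \<le> Re (cinner (sgn x) (H (sgn x)))"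
          using * by (auto simp: R_def norm_sgn)
        then show ?thesis
          using False
          by (simp add: sgn_div_norm bounded_clinear_simps[OF linH] cinner_algebra field_simps
              power2_eq_square)
      qed simp
    next
      fix r assume *: "\<forall>x. a * (norm x)\<^sup>2 \<le> Re (cinner x (H x))" and "r \<in> R"
      then obtain x where "norm x = 1" "r = Re (cinner x (H x))"
        by (auto simp: R_def)
      then show "a \<le> r" using *[rule_format, of x] by simp
    qed
    have ge: "m * (norm x)\<^sup>2 \<le> Re (cinner x (H x))" for x
      using ge_iff[of m] cInf_lower[OF _ \<open>bdd_below R\<close>] by (auto simp: m_def)
    have "m > 0"
    proof (rule ccontr)
      assume "\<not> m > 0"
      then have m: "m \<le> 0" "-2 \<le> m" using m2 by auto
      then have m4: "m\<^sup>2 \<le> 4" using abs_le_square_iff[of m 2] by simp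
      \<comment> \<open>The point of the unit circle with real part \<open>m / 2\<close>. The root
        is real because \<open>m\<^sup>2 \<le> 4\<close>, and \<open>m \<le> 0\<close> puts both
        \<open>z\<close> and \<open>cnj z\<close> in the half-plane where \<open>below\<close>
        applies.\<close>
      define z where "z = Complex (m / 2) (sqrt (1 - m\<^sup>2 / 4))"
      have zz: "z * cnj z = 1" and zs: "z + cnj z = complex_of_real m"
        using m4 by (auto simp: z_def complex_eq_iff power2_eq_square)
      define G where "G x = H x - m *\<^sub>R x" for x
      have linG: "bounded_clinear G"
        unfolding G_def by (intro bounded_clinear_minus linH bounded_clinear_scaleR_const)
      have posG: "positive_op G"
        using linG ge ImH by (simp add: positive_op_def G_def cinner_algebra cinner_self)
      have Rez: "Re z \<le> 0" "Re (cnj z) \<le> 0" using m by (auto simp: z_def)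
      obtain k1 where k1: "k1 > 0" "\<And>x. k1 * norm x \<le> norm (V x - scaleC z x)"
        using below[OF Rez(1)] by blast
      obtain k2 where k2: "k2 > 0" "\<And>x. k2 * norm x \<le> norm (V x - scaleC (cnj z) x)"
        using below[OF Rez(2)] by blast
      have G_ge: "k1 * k2 * norm x \<le> norm (G x)" for x
      proof -
        define y where "y = V x - scaleC (cnj z) x"
        \<comment> \<open>The factorization \<open>(V - z) (V - cnj z) = V G\<close>. As
          \<open>V\<close> is isometric, the two lower bounds multiply to one for
          \<open>G\<close>.\<close>
        have "V y - scaleC z y = V (V x) - scaleC (z + cnj z) (V x) + scaleC (z * cnj z) x"
          by (simp add: y_def bounded_clinear_simps[OF V] scaleC_diff_right scaleC_scaleC
              scaleC_add_left algebra_simps)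
        also have "\<dots> = V (G x)"
          by (simp add: zz zs scaleC_one G_def H_def bounded_clinear_simps[OF V] unitary
              flip: scaleR_scaleC)
        finally have "k1 * norm y \<le> norm (G x)"
          using k1(2)[of y] by (simp add: normV)
        moreover have "k1 * (k2 * norm x) \<le> k1 * norm y"
          using k1(1) k2(2)[of x] by (simp add: y_def)
        ultimately show ?thesis by (simp add: mult.assoc)
      qed
      obtain K where K: "K > 0" "\<And>x. norm (G x) \<le> K * norm x"
        using bounded_clinear_bound[OF linG] by blast
      \<comment> \<open>Combining \<open>norm (G x) \<ge> k1 * k2 * norm x\<close> with
        \<open>G\<^sup>2 \<le> K G\<close> bounds the form of \<open>G\<close> below by
        \<open>d\<close>, so \<open>m + d\<close> is still a lower bound of
        \<open>R\<close>.\<close>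
      define d where "d = (k1 * k2)\<^sup>2 / K"
      have "d > 0" using k1 k2 K by (simp add: d_def)
      have "(m + d) * (norm x)\<^sup>2 \<le> Re (cinner x (H x))" for x
      proof -
        have "(k1 * k2)\<^sup>2 * (norm x)\<^sup>2 \<le> (norm (G x))\<^sup>2"
          using power_mono[OF G_ge[of x], of 2] k1 k2 by (simp add: power_mult_distrib)
        also have "\<dots> \<le> K * Re (cinner x (G x))"
          by (rule positive_op_norm_square_le[OF posG K])
        finally have "d * (norm x)\<^sup>2 \<le> Re (cinner x (G x))"
          using K(1) by (simp add: d_def field_simps)
        then show ?thesis
          by (simp add: G_def cinner_algebra Re_cinner_self algebra_simps)
      qed
      then have "\<forall>r\<in>R. m + d \<le> r" using ge_iff by blast
      then have "m + d \<le> m"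
        unfolding m_def using \<open>R \<noteq> {}\<close> by (intro cInf_greatest) auto
      then show False using \<open>d > 0\<close> by simp
    qed
    then show ?thesis using ge by blast
  qed
  then have "posdef_op H"
    using linH ImH unfolding posdef_op_def positive_op_def
    by (metis less_imp_le mult_nonneg_nonneg order.trans zero_le_power2)
  then show ?thesis by (simp add: H_def[abs_def])
qed

text \<open>The commutator \<open>X = P V - V P\<close> anticommutes with \<open>V\<close>, hence with the positive operator
  \<open>H = V + V\<^sup>*\<close>. So it commutes with \<open>H\<^sup>2\<close> and therefore with \<open>H\<close>, which forces \<open>H X = 0\<close>.\<close>

lemma commute_unitary_of_square:
  fixes V P :: "'a::chilbert \<Rightarrow> 'a"
  assumes V: "bounded_clinear V" and unitary: "\<And>x. adj V (V x) = x" "\<And>x. V (adj V x) = x"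
    and H: "posdef_op (\<lambda>x. V x + adj V x)"
    and P: "bounded_clinear P" and comm: "\<And>x. P (V (V x)) = V (V (P x))"
  shows "P (V x) = V (P x)"
proof -
  have adjV: "bounded_clinear (adj V)" by (rule bounded_clinear_adj[OF V])
  define X where "X x = P (V x) - V (P x)" for x
  have linX: "bounded_clinear X"
    unfolding X_def using V P by (intro bounded_clinear_minus bounded_clinear_compose[of P V]
        bounded_clinear_compose[of V P])
  have VX: "V (X x) = - X (V x)" for x
    by (simp add: X_def bounded_clinear_simps[OF V] comm)
  \<comment> \<open>Multiplying the anticommutation relation by \<open>adj V\<close> on both sides
    transfers it from \<open>V\<close> to its inverse.\<close>
  have adjVX: "adj V (X x) = - X (adj V x)" for x
  proof -
    have "V (X (adj V x)) = - X x" by (simp add: VX unitary)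
    then have "adj V (- X x) = X (adj V x)" by (metis unitary(1))
    then have "X (adj V x) = - adj V (X x)" by (simp add: bounded_clinear_simps[OF adjV])
    then show ?thesis by simp
  qed
  define W where "W x = V x + adj V x" for x
  have W: "posdef_op W" using H by (simp add: W_def[abs_def])
  have WX: "W (X x) = - X (W x)" for x
    by (simp add: W_def VX adjVX bounded_clinear_simps[OF linX])
  have linW: "bounded_clinear W" using W by (simp add: posdef_op_def positive_op_def)
  \<comment> \<open>Moving \<open>X\<close> past \<open>W\<close> twice changes the sign twice, so
    \<open>X\<close> commutes with the square of \<open>W\<close> and hence with
    \<open>W\<close>.\<close>
  have "X (W x) = W (X x)" for x
    by (rule posdef_op_commute_of_square[OF W linX])
      (simp add: WX bounded_clinear_simps[OF linW])
  then have "W (X x) = - W (X x)" using WX by metis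
  then have "2 *\<^sub>R W (X x) = 0" by (metis scaleR_2 add.right_inverse)
  then have "W (X x) = W 0" by (simp add: bounded_clinear_simps[OF linW])
  then have "X x = 0" by (rule posdef_op_inj[OF W])
  then show ?thesis by (simp add: X_def)
qed

lemma op_invertible_norm_ge:
  assumes "op_invertible T"
  obtains k where "k > 0" and "\<And>x. k * norm x \<le> norm (T x)"
proof -
  obtain S where S: "bounded_clinear S" "S \<circ> T = id"
    using assms by (auto simp: op_invertible_def)
  obtain K where K: "K > 0" "\<And>x. norm (S x) \<le> K * norm x"
    using bounded_clinear_bound[OF S(1)] by blast
  have "S (T x) = x" for x using S(2) by (simp add: fun_eq_iff)
  then have "norm x \<le> K * norm (T x)" for x
    using K(2)[of "T x"] by simp
  then have "(1 / K) * norm x \<le> norm (T x)" for x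
    using K(1) by (simp add: field_simps)
  then show ?thesis using that[of "1 / K"] K(1) by simp
qed

lemma commute_unitary_of_square_semicircle:
  fixes U P :: "'a::chilbert \<Rightarrow> 'a"
  assumes U: "bounded_clinear U" and unitary: "\<And>x. adj U (U x) = x" "\<And>x. U (adj U x) = x"
    and spec: "op_spectrum U \<subseteq> {exp (\<i> * complex_of_real t) | t. \<alpha> < t \<and> t < \<alpha> + pi}"
    and P: "bounded_clinear P" and comm: "\<And>x. P (U (U x)) = U (U (P x))"
  shows "P (U x) = U (P x)"
proof -
  \<comment> \<open>This rotation takes the arc from \<open>\<alpha>\<close> to
    \<open>\<alpha> + pi\<close> to the open right half of the unit circle.\<close>
  define c where "c = cis (- (\<alpha> + pi / 2))"
  have c: "cnj c * c = 1" "c * cnj c = 1" "cmod c = 1" "c \<noteq> 0"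
    by (auto simp: c_def cis_cnj cis_mult)
  define V where "V x = scaleC c (U x)" for x
  have V: "bounded_clinear V"
    unfolding V_def by (rule bounded_clinear_compose[OF bounded_clinear_scaleC_const U])
  have adjV: "adj V = (\<lambda>x. scaleC (cnj c) (adj U x))"
    by (rule adj_eqI)
      (simp add: V_def cinner_scaleC_left cinner_scaleC_right cinner_adj_right[OF U])
  note adjU = bounded_clinear_adj[OF U]
  have V_unitary: "adj V (V x) = x" "V (adj V x) = x" for x
    by (simp_all add: adjV V_def bounded_clinear_simps[OF U] bounded_clinear_simps[OF adjU]
        scaleC_scaleC unitary c scaleC_one)
  have "\<exists>k>0. \<forall>x. k * norm x \<le> norm (V x - scaleC z x)" if z: "Re z \<le> 0" for z
  proof -
    \<comment> \<open>In the rotated picture, \<open>z\<close> with \<open>Re z \<le> 0\<close> lies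
      off the spectrum of \<open>V\<close>; the inverse at \<open>z / c\<close> then supplies the
      lower bound.\<close>
    have "z / c \<notin> op_spectrum U"
    proof
      assume "z / c \<in> op_spectrum U"
      then obtain t where t: "\<alpha> < t" "t < \<alpha> + pi" "z / c = cis t"
        using spec by (auto simp: cis_conv_exp)
      have "z = cis t * c" using t(3) c(4) by (simp add: field_simps)
      then have "Re z = cos (t - (\<alpha> + pi / 2))"
        by (simp add: c_def cis_mult algebra_simps)
      moreover have "cos (t - (\<alpha> + pi / 2)) > 0"
        using t by (intro cos_gt_zero_pi) auto
      ultimately show False using z by simp
    qed
    then have "op_invertible (\<lambda>x. scaleC (z / c) x - U x)"
      by (simp add: op_spectrum_def)
    then obtain k where k: "k > 0" "\<And>x. k * norm x \<le> norm (scaleC (z / c) x - U x)"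
      using op_invertible_norm_ge by blast
    have "norm (scaleC (z / c) x - U x) = norm (V x - scaleC z x)" for x
    proof -
      have "scaleC c (scaleC (z / c) x - U x) = scaleC z x - V x"
        using c(4) by (simp add: V_def scaleC_diff_right scaleC_scaleC)
      then show ?thesis using norm_scaleC[of c "scaleC (z / c) x - U x"] c(3)
        by (simp add: norm_minus_commute)
    qed
    then show ?thesis using k by auto
  qed
  then have "posdef_op (\<lambda>x. V x + adj V x)"
    using posdef_op_unitary_plus_adj[OF V V_unitary] by blast
  moreover have "P (V (V x)) = V (V (P x))" for x
    by (simp add: V_def bounded_clinear_simps[OF U] bounded_clinear_simps[OF P] comm)
  ultimately have "P (V x) = V (P x)"
    by (rule commute_unitary_of_square[OF V V_unitary _ P])
  then have "scaleC (cnj c) (scaleC c (P (U x))) = scaleC (cnj c) (scaleC c (U (P x)))"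
    by (simp add: V_def bounded_clinear_simps[OF P])
  then show ?thesis by (simp add: scaleC_scaleC c scaleC_one)
qed

section \<open>The Aluthge transform\<close>

lemma op_invertible_op_abs:
  fixes T :: "'a::chilbert \<Rightarrow> 'a"
  assumes T: "op_invertible T"
  shows posdef_op_abs: "posdef_op (op_abs T)"
    and surj_op_abs: "surj (op_abs T)"
proof -
  have lin: "bounded_clinear T" using T by (simp add: op_invertible_def)
  have pd: "posdef_op (adj T \<circ> T)"
    using op_invertible_norm_ge[OF T] posdef_op_adj_compose[OF lin] by metis
  show "posdef_op (op_abs T)" unfolding op_abs_def by (rule posdef_op_sqrt[OF pd])
  have sq: "op_abs T (op_abs T x) = adj T (T x)" for x
    using op_sqrt_square[OF pd] by (simp add: op_abs_def fun_eq_iff)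
  obtain S where S: "bounded_clinear S" "S \<circ> T = id" "T \<circ> S = id"
    using T by (auto simp: op_invertible_def)
  then have ST: "S (T x) = x" "T (S x) = x" for x by (simp_all add: fun_eq_iff)
  \<comment> \<open>The adjoint of the inverse inverts the adjoint, so the square of
    \<open>op_abs T\<close>, which is \<open>adj T \<circ> T\<close>, is onto, and therefore
    \<open>op_abs T\<close> is too.\<close>
  have "adj T (adj S y) = y" for y
    by (rule cinner_eqI) (simp add: cinner_adj_right[OF lin] cinner_adj_right[OF S(1)] ST)
  then have "op_abs T (op_abs T (S (adj S y))) = y" for y
    by (simp add: sq ST)
  then show "surj (op_abs T)" unfolding surj_def by metis
qed

text \<open>As \<open>op_abs T\<close> is onto, the defect \<open>x - adj U (U x)\<close> is
  orthogonal to every vector, itself included. The other identity holds because \<open>U\<close>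
  inherits surjectivity from \<open>T\<close>.\<close>

lemma polar_decomposition_unitary:
  fixes T U :: "'a::chilbert \<Rightarrow> 'a"
  assumes T: "op_invertible T" and pol: "polar_decomposition T U"
  shows "adj U (U x) = x" and "U (adj U x) = x"
proof -
  have *: "adj U (U x) = x" for x
  proof -
    have "cinner (x - adj U (U x)) (x - adj U (U x)) = 0"
      using pol surj_op_abs[OF T] by (simp add: polar_decomposition_def)
    then show ?thesis by (simp add: cinner_self_eq_zero)
  qed
  then show "adj U (U x) = x" .
  obtain S where "T \<circ> S = id" using T by (auto simp: op_invertible_def)
  then have "x = T (S x)" by (simp add: fun_eq_iff)
  then have "x = U (op_abs T (S x))" using pol by (simp add: polar_decomposition_def)
  then show "U (adj U x) = x" using * by metis
qed

theorem theorem2p5: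
  fixes T U :: "'a::chilbert \<Rightarrow> 'a"
  assumes "op_invertible T"
    and "polar_decomposition T U"
    and "\<exists>\<alpha>::real. op_spectrum U \<subseteq> {exp (\<i> * complex_of_real t) | t. \<alpha> < t \<and> t < \<alpha> + pi}"
  shows "normal_op (aluthge T U) \<longleftrightarrow> normal_op T"
proof -
  define P where "P = op_abs T"
  define A where "A = op_sqrt P"
  define V where "V = adj U"
  have U: "bounded_clinear U" and TU: "T = (\<lambda>x. U (P x))"
    using assms(2) by (auto simp: polar_decomposition_def P_def)
  have V: "bounded_clinear V" unfolding V_def by (rule bounded_clinear_adj[OF U])
  have VU: "V (U x) = x" and UV: "U (V x) = x" for x
    using polar_decomposition_unitary[OF assms(1,2)] by (auto simp: V_def)
  have P: "posdef_op P" unfolding P_def by (rule posdef_op_abs[OF assms(1)])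
  have A: "posdef_op A" unfolding A_def by (rule posdef_op_sqrt[OF P])
  have AA: "A (A x) = P x" for x
    using op_sqrt_square[OF P] by (simp add: A_def fun_eq_iff)
  have pos: "positive_op P" "positive_op A" and lin: "bounded_clinear P" "bounded_clinear A"
    using P A by (auto simp: posdef_op_def positive_op_def)
  note sa = pos[THEN positive_op_selfadjoint]
  have "surj P" unfolding P_def by (rule surj_op_abs[OF assms(1)])
  then have surjA: "\<exists>y. x = A y" for x by (metis AA surjD)
  have adjT: "adj T = (\<lambda>x. P (V x))"
    by (rule adj_eqI) (simp add: TU V_def cinner_adj_right[OF U] flip: sa)
  have N: "aluthge T U = (\<lambda>x. A (U (A x)))"
    by (simp add: aluthge_def A_def P_def o_def)
  have adjN: "adj (aluthge T U) = (\<lambda>x. A (V (A x)))"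
    unfolding N by (rule adj_eqI) (simp add: V_def cinner_adj_right[OF U] flip: sa)
  \<comment> \<open>\<open>adj T \<circ> T\<close> is \<open>P\<^sup>2\<close> and
    \<open>T \<circ> adj T\<close> is \<open>U P\<^sup>2 V\<close>. Substituting \<open>U x\<close>
    for \<open>x\<close> turns equality into commutation of \<open>U\<close> with
    \<open>P\<^sup>2\<close>, hence with \<open>P\<close>.\<close>
  have "normal_op T \<longleftrightarrow> (\<forall>x. P (P x) = U (P (P (V x))))"
    by (simp add: normal_op_def adjT fun_eq_iff) (simp add: TU VU)
  also have "\<dots> \<longleftrightarrow> (\<forall>x. U (P (P x)) = P (P (U x)))"
    by (metis UV VU)
  also have "\<dots> \<longleftrightarrow> (\<forall>x. P (U x) = U (P x))"
    using posdef_op_commute_of_square[OF P U] by metis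
  finally have nT: "normal_op T \<longleftrightarrow> (\<forall>x. P (U x) = U (P x))" .
  have "normal_op (aluthge T U) \<longleftrightarrow> (\<forall>x. A (V (P (U (A x)))) = A (U (P (V (A x)))))"
    by (simp add: normal_op_def adjN fun_eq_iff) (simp add: N AA)
  \<comment> \<open>The outer \<open>A\<close> cancels by injectivity and the inner one by
    surjectivity. Next, substituting \<open>U x\<close> for \<open>x\<close> and applying
    \<open>U\<close> moves both inverses \<open>V\<close> away.\<close>
  also have "\<dots> \<longleftrightarrow> (\<forall>x. V (P (U x)) = U (P (V x)))"
    using posdef_op_inj[OF A] surjA by metis
  also have "\<dots> \<longleftrightarrow> (\<forall>x. P (U (U x)) = U (U (P x)))"
    by (metis UV VU)
  finally have nN: "normal_op (aluthge T U) \<longleftrightarrow> (\<forall>x. P (U (U x)) = U (U (P x)))" .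
  obtain \<alpha> where \<alpha>: "op_spectrum U \<subseteq> {exp (\<i> * complex_of_real t) | t. \<alpha> < t \<and> t < \<alpha> + pi}"
    using assms(3) by blast
  have "P (U x) = U (P x)" if "\<forall>x. P (U (U x)) = U (U (P x))" for x
    by (rule commute_unitary_of_square_semicircle[OF U _ _ \<alpha> lin(1)])
      (use VU UV that in \<open>simp_all add: V_def\<close>)
  then show ?thesis unfolding nT nN by metis
qed

end
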